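(* Let $(X,p)$ be a TVS-cone metric space (with $p:X\times X\to Y$), let $\varphi:K\to K$ be a vectorial comparison function, and let $f:X\to X$ be a map such that \[p(f(x),f(y))\leq_K \varphi(p(x,y))\quad\text{for all } x,y\in X.\] Then there exists a scalar comparison function $\psi:\mathbb{R}_+\to\mathbb{R}_+$ such that \[d_p(f(x),f(y))\leq \psi(d_p(x,y))\quad\text{for all } x,y\in X,\] where $d_p=\xi_e\circ p$.
   Context: Standing setting: $Y$ is a (real) locally convex Hausdorff topological vector space with zero vector $\theta$. A subset $K\subset Y$ is a cone if (i) $K$ is closed, nonempty and $K\neq\{\theta\}$; (ii) $a,b\in\mathbb{R}$, $a,b\ge 0$ and $x,y\in K$ imply $ax+by\in K$; (iii) $K\cap(-K)=\{\theta\}$. $K$ is a fixed cone in $Y$ with $\operatorname{int}K\neq\emptyset$, and $e\in\operatorname{int}K$ is fixed. Write $x\leq_K y$ iff $y-x\in K$, and $x<_K y$ iff $x\leq_K y$ and $x\neq y$. TVS-cone metric space: a nonempty set $X$ with a map $p:X\times X\to Y$ such that (i) $\theta\leq_K p(x,y)$ for all $x,y\in X$, and $p(x,y)=\theta$ iff $x=y$; (ii) $p(x,y)=p(y,x)$ for all $x,y\in X$; (iii) $p(x,y)\leq_K p(x,z)+p(z,y)$ for all $x,y,z\in X$. Nonlinear scalarization function: $\xi_e:Y\to\mathbb{R}$, $\xi_e(y)=\inf\{r\in\mathbb{R}\mid y\in r e-K\}$. The function $d_p=\xi_e\circ p:X\times X\to[0,\infty)$ is a metric on $X$ (known result of Du).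 Vectorial comparison function: a function $\varphi:K\to K$ such that (i) $k_1\leq_K k_2$ implies $\varphi(k_1)\leq_K\varphi(k_2)$; (ii) $\varphi(\theta)=\theta$ and $\theta<_K\varphi(k)<_K k$ for all $k\in K\setminus\{\theta\}$; (iii) $k\in\operatorname{int}K$ implies $k-\varphi(k)\in\operatorname{int}K$; (iv) if $t_0\geq 0$ then $\lim_{t\to t_0^+}\varphi(t e)=\varphi(t_0 e)$. Scalar comparison function: a function $\psi:\mathbb{R}_+\to\mathbb{R}_+$, where $\mathbb{R}_+=[0,\infty)$, such that (i) $t_1\leq t_2$ implies $\psi(t_1)\leq\psi(t_2)$; (ii) $\psi^n(t)\to 0$ as $n\to\infty$ for all $t>0$, where $\psi^n$ is the $n$-th iterate. *)

theory Defs
  imports "HOL-Analysis.Analysis"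
begin

class topological_real_vector = real_vector + topological_ab_group_add +
  assumes tendsto_scaleR_Pair:
    "LIM z (nhds (c::real) \<times>\<^sub>F nhds a). fst z *\<^sub>R snd z :> nhds (c *\<^sub>R a)"

text \<open>
  The library constant \<^const>\<open>convex\<close> cannot be used inside a class specification, so its
  definition is written out; see \<open>locally_convex\<close> below.
\<close>

class locally_convex_space = topological_real_vector + t2_space +
  assumes locally_convex_unfolded:
    "open U \<Longrightarrow> 0 \<in> U \<Longrightarrow> \<exists>V. open V \<and>
      (\<forall>x\<in>V. \<forall>y\<in>V. \<forall>u\<ge>0. \<forall>v\<ge>0. u + v = 1 \<longrightarrow> u *\<^sub>R x + v *\<^sub>R y \<in> V) \<and>
      0 \<in> V \<and> V \<subseteq> U"

lemma locally_convex:
  fixes U :: "'a::locally_convex_space set"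
  shows "open U \<Longrightarrow> 0 \<in> U \<Longrightarrow> \<exists>V. open V \<and> convex V \<and> 0 \<in> V \<and> V \<subseteq> U"
  unfolding convex_def by (rule locally_convex_unfolded)

instance real_normed_vector \<subseteq> locally_convex_space
proof
  fix c :: real and a :: 'a
  have "((\<lambda>z. fst z *\<^sub>R snd z) \<longlongrightarrow> fst (c, a) *\<^sub>R snd (c, a)) (nhds (c, a))"
    by (intro tendsto_intros filterlim_ident)
  then show "LIM z (nhds c \<times>\<^sub>F nhds a). fst z *\<^sub>R snd z :> nhds (c *\<^sub>R a)"
    by (simp add: nhds_prod)
next
  fix U :: "'a set"
  assume "open U" "0 \<in> U"
  then obtain r where "r > 0" "ball 0 r \<subseteq> U"
    by (meson open_contains_ball)
  then have "\<exists>V. open V \<and> convex V \<and> 0 \<in> V \<and> V \<subseteq> U"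
    by (intro exI[of _ "ball 0 r"]) auto
  then show "\<exists>V. open V \<and>
      (\<forall>x\<in>V. \<forall>y\<in>V. \<forall>u\<ge>0. \<forall>v\<ge>0. u + v = 1 \<longrightarrow> u *\<^sub>R x + v *\<^sub>R y \<in> V) \<and>
      0 \<in> V \<and> V \<subseteq> U"
    unfolding convex_def .
qed

text \<open>
  Unlike \<^const>\<open>cone\<close> from the library, a cone is here closed, convex, pointed and nontrivial.
\<close>

definition tvs_cone :: "'y::locally_convex_space set \<Rightarrow> bool" where
  "tvs_cone K \<longleftrightarrow>
     closed K \<and> K \<noteq> {} \<and> K \<noteq> {0} \<and>
     (\<forall>a b x y. 0 \<le> a \<longrightarrow> 0 \<le> b \<longrightarrow> x \<in> K \<longrightarrow> y \<in> K \<longrightarrow> a *\<^sub>R x + b *\<^sub>R y \<in> K) \<and>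
     K \<inter> uminus ` K = {0}"

definition cone_le :: "'y::locally_convex_space \<Rightarrow> 'y set \<Rightarrow> 'y \<Rightarrow> bool"
    (\<open>(_/ \<preceq>\<^bsub>_\<^esub> _)\<close> [51, 0, 51] 50) where
  "x \<preceq>\<^bsub>K\<^esub> y \<longleftrightarrow> y - x \<in> K"

definition cone_less :: "'y::locally_convex_space \<Rightarrow> 'y set \<Rightarrow> 'y \<Rightarrow> bool"
    (\<open>(_/ \<prec>\<^bsub>_\<^esub> _)\<close> [51, 0, 51] 50) where
  "x \<prec>\<^bsub>K\<^esub> y \<longleftrightarrow> x \<preceq>\<^bsub>K\<^esub> y \<and> x \<noteq> y"

definition tvs_cone_metric_space ::
    "'y::locally_convex_space set \<Rightarrow> 'x set \<Rightarrow> ('x \<Rightarrow> 'x \<Rightarrow> 'y) \<Rightarrow> bool" where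
  "tvs_cone_metric_space K X p \<longleftrightarrow>
     X \<noteq> {} \<and>
     (\<forall>x\<in>X. \<forall>y\<in>X. 0 \<preceq>\<^bsub>K\<^esub> p x y \<and> (p x y = 0 \<longleftrightarrow> x = y)) \<and>
     (\<forall>x\<in>X. \<forall>y\<in>X. p x y = p y x) \<and>
     (\<forall>x\<in>X. \<forall>y\<in>X. \<forall>z\<in>X. p x y \<preceq>\<^bsub>K\<^esub> p x z + p z y)"

definition scalarization :: "'y::locally_convex_space set \<Rightarrow> 'y \<Rightarrow> 'y \<Rightarrow> real" where
  "scalarization K e y = Inf {r. y \<in> (\<lambda>k. r *\<^sub>R e - k) ` K}"

definition scalarized_dist ::
    "'y::locally_convex_space set \<Rightarrow> 'y \<Rightarrow> ('x \<Rightarrow> 'x \<Rightarrow> 'y) \<Rightarrow> 'x \<Rightarrow> 'x \<Rightarrow> real" where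
  "scalarized_dist K e p x y = scalarization K e (p x y)"

text \<open>Only the values of \<open>\<phi>\<close> on \<open>K\<close>, and below those of \<open>\<psi>\<close> on \<open>{0..}\<close>, are relevant.\<close>

definition vectorial_comparison ::
    "'y::locally_convex_space set \<Rightarrow> 'y \<Rightarrow> ('y \<Rightarrow> 'y) \<Rightarrow> bool" where
  "vectorial_comparison K e \<phi> \<longleftrightarrow>
     \<phi> \<in> K \<rightarrow> K \<and>
     (\<forall>k1\<in>K. \<forall>k2\<in>K. k1 \<preceq>\<^bsub>K\<^esub> k2 \<longrightarrow> \<phi> k1 \<preceq>\<^bsub>K\<^esub> \<phi> k2) \<and>
     \<phi> 0 = 0 \<and> (\<forall>k\<in>K - {0}. 0 \<prec>\<^bsub>K\<^esub> \<phi> k \<and> \<phi> k \<prec>\<^bsub>K\<^esub> k) \<and>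
     (\<forall>k\<in>interior K. k - \<phi> k \<in> interior K) \<and>
     (\<forall>t0\<ge>0. ((\<lambda>t. \<phi> (t *\<^sub>R e)) \<longlongrightarrow> \<phi> (t0 *\<^sub>R e)) (at_right t0))"

definition scalar_comparison :: "(real \<Rightarrow> real) \<Rightarrow> bool" where
  "scalar_comparison \<psi> \<longleftrightarrow>
     \<psi> \<in> {0..} \<rightarrow> {0..} \<and>
     mono_on {0..} \<psi> \<and>
     (\<forall>t>0. (\<lambda>n. (\<psi> ^^ n) t) \<longlonglongrightarrow> 0)"

end

(* The comparison function is \<psi> t = \<xi>\<^sub>e (\<phi> (t e)). Since K is closed, the infimum defining \<xi>\<^sub>e is
   attained, so y \<le> \<xi>\<^sub>e(y) e; monotonicity of \<phi> and \<xi>\<^sub>e then gives the contraction estimate.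
   As t e - \<phi>(t e) lies in the interior of K, we have \<psi> t < t for t > 0, and the right continuity
   of \<phi> along the ray through e makes \<psi> upper semicontinuous from the right. Hence the decreasing
   iterates of \<psi> cannot have a positive limit. *)

theory Submission
  imports Defs
begin

section \<open>Limits in topological vector spaces and iteration of real functions\<close>

lemma tendsto_scaleR_tvs:
  fixes g :: "'a \<Rightarrow> 'y::topological_real_vector"
  assumes "(c \<longlongrightarrow> a) F" "(g \<longlongrightarrow> b) F"
  shows "((\<lambda>x. c x *\<^sub>R g x) \<longlongrightarrow> a *\<^sub>R b) F"
  using filterlim_compose[OF tendsto_scaleR_Pair filterlim_Pair[OF assms]] by simp

lemma eventually_in_of_tendsto_interior:
  assumes "(g \<longlongrightarrow> y) F" "y \<in> interior K"
  shows "\<forall>\<^sub>F x in F. g x \<in> K"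
  using topological_tendstoD[OF assms(1) open_interior assms(2)]
  by (rule eventually_mono) (use interior_subset in blast)

text \<open>The iterates decrease to some L \<ge> 0. If L were positive, semicontinuity would keep
  \<psi> below L just to the right of L; an iterate that has come this close would then be followed
  by one below L, although L bounds all iterates from below.\<close>

lemma funpow_tendsto_0_of_right_usc:
  fixes \<psi> :: "real \<Rightarrow> real"
  assumes nonneg: "\<And>t. 0 \<le> t \<Longrightarrow> 0 \<le> \<psi> t"
    and zero: "\<psi> 0 = 0"
    and less: "\<And>t. 0 < t \<Longrightarrow> \<psi> t < t"
    and usc: "\<And>t s. 0 \<le> t \<Longrightarrow> \<psi> t < s \<Longrightarrow> \<forall>\<^sub>F u in at_right t. \<psi> u < s"
    and t: "0 \<le> t"
  shows "(\<lambda>n. (\<psi> ^^ n) t) \<longlonglongrightarrow> 0"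
proof -
  let ?u = "\<lambda>n. (\<psi> ^^ n) t"
  have ge0: "0 \<le> ?u n" for n
    by (induction n) (use t nonneg in auto)
  have le: "\<psi> x \<le> x" if "0 \<le> x" for x
    using that zero less[of x] by (cases "x = 0") auto
  have dec: "decseq ?u"
    by (rule decseq_SucI) (use le ge0 in auto)
  obtain L where lim: "?u \<longlonglongrightarrow> L" and L: "\<And>n. L \<le> ?u n"
    using decseq_convergent[OF dec, of 0] ge0 by blast
  have "0 \<le> L"
    using lim ge0 by (intro LIMSEQ_le_const[of ?u L 0]) auto
  moreover have False if pos: "0 < L"
  proof -
    \<comment> \<open>Semicontinuity is applied at L with the threshold L itself, which is
      admissible because \<psi>(L) < L.\<close>
    obtain b where b: "b > L" "\<And>u. L < u \<Longrightarrow> u < b \<Longrightarrow> \<psi> u < L"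
      using usc[of L L] less[OF pos] pos by (auto simp: eventually_at_right_field)
    obtain n where n: "?u n < b"
      using order_tendstoD(2)[OF lim b(1)] eventually_sequentially by auto
    \<comment> \<open>The bound from \<open>b\<close> covers only points strictly to the right of L;
      an iterate equal to L is handled by \<psi>(L) < L directly.\<close>
    have "\<psi> (?u n) < L"
      using b(2)[of "?u n"] n L[of n] less[OF pos] by (cases "?u n = L") auto
    then show False
      using L[of "Suc n"] by simp
  qed
  ultimately show ?thesis
    using lim by (cases "L = 0") auto
qed

section \<open>Geometry of a cone with an interior point\<close>

locale solid_cone =
  fixes K :: "'y::locally_convex_space set" and e :: 'y
  assumes cone: "tvs_cone K" and e_interior: "e \<in> interior K"
begin

lemma closed_K: "closed K"
  and comb_mem: "0 \<le> a \<Longrightarrow> 0 \<le> b \<Longrightarrow> x \<in> K \<Longrightarrow> y \<in> K \<Longrightarrow> a *\<^sub>R x + b *\<^sub>R y \<in> K"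
  and K_ne_0: "K \<noteq> {0}"
  and pointed: "K \<inter> uminus ` K = {0}"
  using cone unfolding tvs_cone_def by blast+

lemma add_mem: "x \<in> K \<Longrightarrow> y \<in> K \<Longrightarrow> x + y \<in> K"
  using comb_mem[of 1 1 x y] by simp

lemma scaleR_mem: "0 \<le> a \<Longrightarrow> x \<in> K \<Longrightarrow> a *\<^sub>R x \<in> K"
  using comb_mem[of a 0 x x] by simp

lemma zero_mem: "0 \<in> K"
  using pointed by blast

lemma antisym: "x \<in> K \<Longrightarrow> - x \<in> K \<Longrightarrow> x = 0"
  using pointed by (metis IntI image_eqI minus_minus singletonD)

lemma e_mem: "e \<in> K"
  using e_interior interior_subset by blast

text \<open>As t tends to 0 from the right, y + t z tends to the interior point y, so it lies in K
  for small t. This is how interior points enter most estimates below.\<close>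

lemma absorbing:
  assumes y: "y \<in> interior K"
  shows "\<exists>t>0. y + t *\<^sub>R z \<in> K"
proof -
  have "((\<lambda>t::real. y + t *\<^sub>R z) \<longlongrightarrow> y + 0 *\<^sub>R z) (at_right 0)"
    by (intro tendsto_add tendsto_const tendsto_scaleR_tvs tendsto_ident_at)
  then have "\<forall>\<^sub>F t in at_right 0. y + t *\<^sub>R z \<in> K"
    using y by (intro eventually_in_of_tendsto_interior) auto
  then obtain b :: real where b: "b > 0" "\<And>t. 0 < t \<Longrightarrow> t < b \<Longrightarrow> y + t *\<^sub>R z \<in> K"
    by (auto simp: eventually_at_right_field)
  then show ?thesis
    by (intro exI[of _ "b / 2"]) auto
qed

text \<open>If 0 were interior, a small positive multiple of -x would lie in K for every x in K,
  hence so would -x, and pointedness would collapse K to {0}.\<close>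

lemma zero_not_interior: "0 \<notin> interior K"
proof
  assume 0: "0 \<in> interior K"
  have "x = 0" if x: "x \<in> K" for x
  proof -
    obtain t where t: "t > 0" "0 + t *\<^sub>R (- x) \<in> K"
      using absorbing[OF 0] by blast
    have "- x \<in> K"
      using scaleR_mem[of "1 / t" "t *\<^sub>R (- x)"] t by simp
    then show ?thesis
      using antisym x by blast
  qed
  then show False
    using K_ne_0 zero_mem by blast
qed

lemma uminus_e_not_mem: "- e \<notin> K"
  using antisym[OF e_mem] e_interior zero_not_interior by auto

text \<open>Scaling by 1/t is continuous and sends t e to e, so it maps a neighbourhood of t e into
  K; scaling back by t shows that this neighbourhood lies in K.\<close>

lemma scaleR_e_interior:
  assumes t: "0 < t"
  shows "t *\<^sub>R e \<in> interior K"
proof -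
  have "((\<lambda>y. (1 / t) *\<^sub>R y) \<longlongrightarrow> (1 / t) *\<^sub>R (t *\<^sub>R e)) (nhds (t *\<^sub>R e))"
    by (intro tendsto_scaleR_tvs tendsto_const filterlim_ident)
  then have "\<forall>\<^sub>F y in nhds (t *\<^sub>R e). (1 / t) *\<^sub>R y \<in> K"
    using t e_interior by (intro eventually_in_of_tendsto_interior) auto
  then have "\<forall>\<^sub>F y in nhds (t *\<^sub>R e). y \<in> K"
  proof (rule eventually_mono)
    fix y assume "(1 / t) *\<^sub>R y \<in> K"
    then show "y \<in> K"
      using scaleR_mem[of t "(1 / t) *\<^sub>R y"] t by simp
  qed
  then show ?thesis
    unfolding eventually_nhds by (meson interiorI subsetI)
qed

lemma scaleR_e_mem: "0 \<le> t \<Longrightarrow> t *\<^sub>R e \<in> K"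
  by (rule scaleR_mem[OF _ e_mem])

section \<open>The scalarization function on the cone\<close>

lemma scalarization_eq: "scalarization K e y = Inf {r. r *\<^sub>R e - y \<in> K}"
proof -
  have "y \<in> (\<lambda>k. r *\<^sub>R e - k) ` K \<longleftrightarrow> r *\<^sub>R e - y \<in> K" for r
    by (auto intro: image_eqI[of _ _ "r *\<^sub>R e - y"])
  then show ?thesis
    by (simp add: scalarization_def)
qed

lemma upper_bound_nonneg:
  assumes y: "y \<in> K" and r: "r *\<^sub>R e - y \<in> K"
  shows "0 \<le> r"
proof (rule ccontr)
  assume "\<not> 0 \<le> r"
  moreover have "r *\<^sub>R e \<in> K"
    using add_mem[OF r y] by simp
  \<comment> \<open>For r < 0 the factor -1/r is positive and turns r e into -e.\<close>
  ultimately have "- e \<in> K"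
    using scaleR_mem[of "- 1 / r" "r *\<^sub>R e"] by (simp add: divide_nonpos_neg)
  then show False
    using uminus_e_not_mem by blast
qed

lemma bdd_below_upper_bounds: "y \<in> K \<Longrightarrow> bdd_below {r. r *\<^sub>R e - y \<in> K}"
  using upper_bound_nonneg by (intro bdd_belowI[of _ 0]) auto

text \<open>Since e is interior, e - t y lies in K for some t > 0; dividing by t makes 1/t an
  admissible value.\<close>

lemma upper_bounds_nonempty: "{r. r *\<^sub>R e - y \<in> K} \<noteq> {}"
proof -
  obtain t where t: "t > 0" "e + t *\<^sub>R (- y) \<in> K"
    using absorbing[OF e_interior] by blast
  have "(1 / t) *\<^sub>R e - y \<in> K"
    using scaleR_mem[of "1 / t" "e + t *\<^sub>R (- y)"] t by (simp add: algebra_simps)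
  then show ?thesis
    by blast
qed

lemma scalarization_le: "y \<in> K \<Longrightarrow> r *\<^sub>R e - y \<in> K \<Longrightarrow> scalarization K e y \<le> r"
  unfolding scalarization_eq by (rule cInf_lower) (auto intro: bdd_below_upper_bounds)

lemma scalarization_nonneg: "y \<in> K \<Longrightarrow> 0 \<le> scalarization K e y"
  unfolding scalarization_eq using upper_bounds_nonempty upper_bound_nonneg
  by (intro cInf_greatest) auto

lemma scalarization_attained:
  assumes y: "y \<in> K"
  shows "scalarization K e y *\<^sub>R e - y \<in> K"
proof -
  let ?s = "scalarization K e y"
  \<comment> \<open>Admissible values are closed upwards, as nonnegative multiples of e may be
    added, so everything strictly above the infimum is admissible. Closedness of K then carries
    membership to the limit.\<close>
  have "(?s + inverse (real (Suc n))) *\<^sub>R e - y \<in> K" for n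
  proof -
    have "?s < ?s + inverse (real (Suc n))"
      by simp
    then obtain r where r: "r *\<^sub>R e - y \<in> K" "r < ?s + inverse (real (Suc n))"
      using cInf_lessD[OF upper_bounds_nonempty] unfolding scalarization_eq by blast
    then show ?thesis
      using add_mem[OF r(1) scaleR_e_mem[of "?s + inverse (real (Suc n)) - r"]]
      by (simp add: algebra_simps)
  qed
  moreover have "(\<lambda>n. (?s + inverse (real (Suc n))) *\<^sub>R e - y) \<longlonglongrightarrow> (?s + 0) *\<^sub>R e - y"
    by (intro tendsto_diff tendsto_scaleR_tvs tendsto_add tendsto_const LIMSEQ_inverse_real_of_nat)
  ultimately show ?thesis
    using closed_sequentially[OF closed_K, of "\<lambda>n. (?s + inverse (real (Suc n))) *\<^sub>R e - y"]
    by (metis add.right_neutral)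
qed

lemma scalarization_mono:
  assumes "x \<in> K" "y \<in> K" "x \<preceq>\<^bsub>K\<^esub> y"
  shows "scalarization K e x \<le> scalarization K e y"
  using add_mem[OF scalarization_attained[OF assms(2)], of "y - x"] assms
  by (intro scalarization_le) (auto simp: cone_le_def)

lemma scalarization_0: "scalarization K e 0 = 0"
  using scalarization_le[of 0 0] scalarization_nonneg[of 0] zero_mem by simp

text \<open>Interiority leaves room to subtract t e for some t > 0, so that even r - t is
  admissible.\<close>

lemma scalarization_less:
  assumes y: "y \<in> K" and r: "r *\<^sub>R e - y \<in> interior K"
  shows "scalarization K e y < r"
proof -
  obtain t where "t > 0" "r *\<^sub>R e - y + t *\<^sub>R (- e) \<in> K"
    using absorbing[OF r] by blast
  then show ?thesis
    using scalarization_le[OF y, of "r - t"] by (simp add: algebra_simps)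
qed

text \<open>For \<epsilon> > 0 the vector \<epsilon> e is interior, so g(x) - y is eventually
  dominated by \<epsilon> e. Adding the attained bound for y bounds g(x) by a multiple of e.\<close>

lemma scalarization_usc:
  assumes lim: "(g \<longlongrightarrow> y) F" and y: "y \<in> K" and g: "\<forall>\<^sub>F x in F. g x \<in> K"
    and s: "scalarization K e y < s"
  shows "\<forall>\<^sub>F x in F. scalarization K e (g x) < s"
proof -
  \<comment> \<open>Half the gap: the resulting bound on the scalarization is only non-strict and
    must still fall strictly below s.\<close>
  define \<epsilon> where "\<epsilon> = (s - scalarization K e y) / 2"
  have \<epsilon>: "\<epsilon> > 0" "scalarization K e y + \<epsilon> < s"
    using s by (auto simp: \<epsilon>_def field_simps)
  have "((\<lambda>x. \<epsilon> *\<^sub>R e - (g x - y)) \<longlongrightarrow> \<epsilon> *\<^sub>R e - (y - y)) F"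
    by (intro tendsto_diff tendsto_const lim)
  then have "\<forall>\<^sub>F x in F. \<epsilon> *\<^sub>R e - (g x - y) \<in> K"
    using scaleR_e_interior[OF \<epsilon>(1)] by (intro eventually_in_of_tendsto_interior) auto
  with g show ?thesis
  proof eventually_elim
    case (elim x)
    then have "(scalarization K e y + \<epsilon>) *\<^sub>R e - g x \<in> K"
      using add_mem[OF scalarization_attained[OF y]] by (fastforce simp: algebra_simps)
    then show ?case
      using scalarization_le[OF elim(1)] \<epsilon>(2) by fastforce
  qed
qed

section \<open>The scalar comparison function and the contraction estimate\<close>

lemma scalar_comparison_scalarization:
  assumes \<phi>: "vectorial_comparison K e \<phi>"
  shows "scalar_comparison (\<lambda>t. scalarization K e (\<phi> (t *\<^sub>R e)))"
    (is "scalar_comparison ?\<psi>")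
proof -
  have mem: "\<phi> (t *\<^sub>R e) \<in> K" if "0 \<le> t" for t
    using \<phi> scaleR_e_mem[OF that] unfolding vectorial_comparison_def by blast
  have nonneg: "0 \<le> ?\<psi> t" if "0 \<le> t" for t
    using mem[OF that] by (rule scalarization_nonneg)
  have "mono_on {0..} ?\<psi>"
  proof (rule mono_onI)
    fix s t :: real
    assume st: "s \<in> {0..}" "t \<in> {0..}" "s \<le> t"
    have "s *\<^sub>R e \<preceq>\<^bsub>K\<^esub> t *\<^sub>R e"
      using scaleR_e_mem[of "t - s"] st by (simp add: cone_le_def algebra_simps)
    then have "\<phi> (s *\<^sub>R e) \<preceq>\<^bsub>K\<^esub> \<phi> (t *\<^sub>R e)"
      using \<phi> scaleR_e_mem st unfolding vectorial_comparison_def by simp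
    then show "?\<psi> s \<le> ?\<psi> t"
      using mem st by (intro scalarization_mono) auto
  qed
  moreover have "(\<lambda>n. (?\<psi> ^^ n) t) \<longlonglongrightarrow> 0" if "t > 0" for t
  proof (rule funpow_tendsto_0_of_right_usc)
    show "?\<psi> 0 = 0"
      using \<phi> scalarization_0 by (simp add: vectorial_comparison_def)
    \<comment> \<open>The third condition on \<phi>, at the interior point t e, is exactly the
      interiority required by \<open>scalarization_less\<close>.\<close>
    show "?\<psi> t < t" if "0 < t" for t
      using \<phi> mem that scaleR_e_interior[OF that]
      by (intro scalarization_less) (auto simp: vectorial_comparison_def)
    show "\<forall>\<^sub>F u in at_right t. ?\<psi> u < s" if t: "0 \<le> t" and "?\<psi> t < s" for t s
    proof (rule scalarization_usc)
      show "((\<lambda>u. \<phi> (u *\<^sub>R e)) \<longlongrightarrow> \<phi> (t *\<^sub>R e)) (at_right t)"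
        using \<phi> t by (simp add: vectorial_comparison_def)
      show "\<forall>\<^sub>F u in at_right t. \<phi> (u *\<^sub>R e) \<in> K"
        using eventually_at_right_less[of t] by eventually_elim (use t mem in auto)
    qed (use that mem in auto)
  qed (use that nonneg in auto)
  ultimately show ?thesis
    unfolding scalar_comparison_def using nonneg by auto
qed

end

theorem theorem2p1:
  fixes K :: "'y::locally_convex_space set" and e :: 'y
    and X :: "'x set" and p :: "'x \<Rightarrow> 'x \<Rightarrow> 'y"
    and \<phi> :: "'y \<Rightarrow> 'y" and f :: "'x \<Rightarrow> 'x"
  assumes "tvs_cone K" and "interior K \<noteq> {}" and "e \<in> interior K"
    and "tvs_cone_metric_space K X p"
    and "vectorial_comparison K e \<phi>"
    and "f \<in> X \<rightarrow> X"
    and "\<forall>x\<in>X. \<forall>y\<in>X. p (f x) (f y) \<preceq>\<^bsub>K\<^esub> \<phi> (p x y)"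
  shows "\<exists>\<psi>. scalar_comparison \<psi> \<and>
    (\<forall>x\<in>X. \<forall>y\<in>X. scalarized_dist K e p (f x) (f y) \<le> \<psi> (scalarized_dist K e p x y))"
proof -
  interpret solid_cone K e
    by unfold_locales (fact assms)+
  have p_mem: "p x y \<in> K" if "x \<in> X" "y \<in> X" for x y
    using assms(4) that unfolding tvs_cone_metric_space_def cone_le_def by simp
  have \<phi>_mem: "\<phi> k \<in> K" if "k \<in> K" for k
    using assms(5) that unfolding vectorial_comparison_def by blast
  have "scalarized_dist K e p (f x) (f y)
      \<le> scalarization K e (\<phi> (scalarized_dist K e p x y *\<^sub>R e))"
    if x: "x \<in> X" and y: "y \<in> X" for x y
  proof -
    let ?d = "scalarization K e (p x y)"
    have fxy: "p (f x) (f y) \<in> K"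
      using assms(6) x y by (intro p_mem) auto
    have d_mem: "?d *\<^sub>R e \<in> K"
      using p_mem[OF x y] by (intro scaleR_e_mem scalarization_nonneg)
    \<comment> \<open>Attainment of the infimum replaces the vector p(x,y) by a point on the ray
      through e, the only place where \<psi> sees \<phi>.\<close>
    have "p x y \<preceq>\<^bsub>K\<^esub> ?d *\<^sub>R e"
      unfolding cone_le_def using p_mem[OF x y] by (rule scalarization_attained)
    then have "\<phi> (p x y) \<preceq>\<^bsub>K\<^esub> \<phi> (?d *\<^sub>R e)"
      using assms(5) p_mem[OF x y] d_mem unfolding vectorial_comparison_def by blast
    then have "scalarization K e (\<phi> (p x y)) \<le> scalarization K e (\<phi> (?d *\<^sub>R e))"
      using \<phi>_mem p_mem[OF x y] d_mem by (intro scalarization_mono) auto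
    moreover have "scalarization K e (p (f x) (f y)) \<le> scalarization K e (\<phi> (p x y))"
      using assms(7) x y fxy \<phi>_mem p_mem[OF x y] by (intro scalarization_mono) auto
    ultimately show ?thesis
      by (simp add: scalarized_dist_def)
  qed
  then show ?thesis
    using scalar_comparison_scalarization[OF assms(5)] by blast
qed

end
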